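(* Let $\mathcal{L}\subset\mathbb{S}^n$ be a proper Jordan subalgebra. Then $\operatorname{codim}(\mathcal{L})\ge n-1$, where the codimension is that of $\mathcal{L}$ as a linear subspace of $\mathbb{S}^n$.
   Context: $\mathbb{S}^n$ is the space of symmetric $n\times n$ matrices over $\mathbb{C}$. A Jordan subalgebra of $\mathbb{S}^n$ is a linear subspace $\mathcal{L}\subset\mathbb{S}^n$ containing an invertible matrix $U$ such that $\mathcal{L}$ is closed under $X\bullet_U Y=\frac12(XU^{-1}Y+YU^{-1}X)$ (so $U$ is its unit). Proper means $\mathcal{L}\neq\mathbb{S}^n$. *)

theory Defs
  imports "HOL-Analysis.Analysis"
begin

(* The library gives 'complex ^ 'n ^ 'n' only its real vector space structure. All subspaces and
   dimensions below are over the complex numbers, so the complex structure is set up here. *)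

definition cmat_scale :: "complex \<Rightarrow> complex ^ 'n ^ 'n \<Rightarrow> complex ^ 'n ^ 'n"  (infixr "*\<^sub>M" 75)
  where "c *\<^sub>M A = (\<chi> i j. c * A $ i $ j)"

lemma cmat_scale_nth [simp]: "(c *\<^sub>M A) $ i $ j = c * A $ i $ j"
  by (simp add: cmat_scale_def)

definition matrix_unit :: "'n \<times> 'n \<Rightarrow> complex ^ 'n ^ 'n"
  where "matrix_unit p = (\<chi> i j. if p = (i, j) then 1 else 0)"

lemma matrix_unit_nth [simp]: "matrix_unit p $ i $ j = (if p = (i, j) then 1 else 0)"
  by (simp add: matrix_unit_def)

lemma inj_matrix_unit: "inj matrix_unit"
proof (rule injI)
  fix p q :: "'n::finite \<times> 'n"
  assume "matrix_unit p = matrix_unit q"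
  then have "matrix_unit p $ fst p $ snd p = matrix_unit q $ fst p $ snd p"
    by simp
  then show "p = q"
    by (simp split: if_splits)
qed

global_interpretation cmat: vector_space "(*\<^sub>M)"
  by unfold_locales (simp_all add: vec_eq_iff algebra_simps)

lemma sum_matrix_unit_nth:
  fixes f :: "'n::finite \<times> 'n \<Rightarrow> complex"
  shows "(\<Sum>p\<in>UNIV. f p *\<^sub>M matrix_unit p) $ i $ j = f (i, j)"
proof -
  have "(\<Sum>p\<in>UNIV. f p *\<^sub>M matrix_unit p) $ i $ j
      = (\<Sum>p\<in>UNIV. if p = (i, j) then f p else 0)"
    by (simp add: if_distrib cong: if_cong)
  then show ?thesis
    by simp
qed

global_interpretation cmat: finite_dimensional_vector_space
    "(*\<^sub>M) :: complex \<Rightarrow> complex ^ 'n ^ 'n \<Rightarrow> complex ^ 'n ^ 'n"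
    "range matrix_unit"
proof unfold_locales
  show "finite (range matrix_unit :: (complex ^ 'n ^ 'n) set)"
    by simp
  show "cmat.independent (range matrix_unit :: (complex ^ 'n ^ 'n) set)"
  proof (rule cmat.independent_if_scalars_zero)
    fix f :: "complex ^ 'n ^ 'n \<Rightarrow> complex" and x :: "complex ^ 'n ^ 'n"
    assume 0: "(\<Sum>x\<in>range matrix_unit. f x *\<^sub>M x) = 0" and "x \<in> range matrix_unit"
    then obtain i j where x: "x = matrix_unit (i, j)"
      by auto
    have "(\<Sum>p\<in>UNIV. f (matrix_unit p) *\<^sub>M matrix_unit p) = 0"
      using 0 by (simp add: sum.reindex inj_matrix_unit)
    then show "f x = 0"
      using sum_matrix_unit_nth[of "\<lambda>p. f (matrix_unit p)" i j] x by simp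
  qed simp
  show "cmat.span (range matrix_unit) = (UNIV :: (complex ^ 'n ^ 'n) set)"
  proof (intro equalityI subsetI UNIV_I)
    fix A :: "complex ^ 'n ^ 'n"
    have "A = (\<Sum>p\<in>UNIV. (A $ fst p $ snd p) *\<^sub>M matrix_unit p)"
      by (simp only: vec_eq_iff sum_matrix_unit_nth) simp
    also have "\<dots> \<in> cmat.span (range matrix_unit)"
      by (intro cmat.span_sum cmat.span_scale cmat.span_base) auto
    finally show "A \<in> cmat.span (range matrix_unit)" .
  qed
qed

definition symmetric_matrices :: "(complex ^ 'n ^ 'n) set"
  where "symmetric_matrices = {A. transpose A = A}"

definition jordan_prod ::
    "complex ^ 'n ^ 'n \<Rightarrow> complex ^ 'n ^ 'n \<Rightarrow> complex ^ 'n ^ 'n \<Rightarrow> complex ^ 'n ^ 'n"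
  where "jordan_prod U X Y =
    (1 / 2) *\<^sub>M (X ** matrix_inv U ** Y + Y ** matrix_inv U ** X)"

definition jordan_subalgebra :: "(complex ^ 'n ^ 'n) set \<Rightarrow> bool"
  where "jordan_subalgebra L \<longleftrightarrow>
    L \<subseteq> symmetric_matrices \<and> cmat.subspace L \<and>
    (\<exists>U\<in>L. invertible U \<and> (\<forall>X\<in>L. \<forall>Y\<in>L. jordan_prod U X Y \<in> L))"

(* Meant for subspaces L of V. Then dim L is at most dim V, so the subtraction on nat is exact. *)
definition codim_in :: "(complex ^ 'n ^ 'n) set \<Rightarrow> (complex ^ 'n ^ 'n) set \<Rightarrow> nat"
  where "codim_in V L = cmat.dim V - cmat.dim L"

end

theory Submission
  imports Defs
begin

text \<open>
  Let \<open>V\<close> be the inverse of the unit \<open>U\<close>, let \<open>n\<close> be the size of the matrices, and let \<open>M\<close> be the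
  annihilator of \<open>L\<close> in the symmetric matrices for the form \<open>trace (X ** Y)\<close>. This form is
  nondegenerate, so the codimension of \<open>L\<close> is the dimension of \<open>M\<close>, and \<open>M\<close> is nonzero as \<open>L\<close> is
  proper. The task is to prove \<open>dim M \<ge> n - 1\<close>.

  Associativity of the trace form turns the closure of \<open>L\<close> under the Jordan product into an action
  on \<open>M\<close>: for \<open>X \<in> L\<close> and \<open>Y \<in> M\<close>, the matrix \<open>sandwich V Y X = V X Y + Y X V\<close> lies in \<open>M\<close>. As
  \<open>sandwich V Y\<close> is self-adjoint, it also produces members of \<open>M\<close> from matrices outside \<open>L\<close>: fix a
  vector \<open>x\<close> and let \<open>R\<close> be the space of all \<open>sandwich V Y X x\<close> with \<open>X \<in> L\<close> (called the orbit
  below). If \<open>c\<close> is orthogonal to \<open>R\<close>, then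
  \<open>B c = sandwich V Y (x c\<^sup>T + c x\<^sup>T)\<close> lies in \<open>M\<close>.

  Evaluation at \<open>x\<close> maps \<open>M\<close> onto a space that contains \<open>R\<close>, which gives \<open>dim R\<close> dimensions of \<open>M\<close>.
  Suppose that \<open>V x\<close> and \<open>Y x\<close> are linearly independent and that \<open>x\<close> is isotropic for both quadratic
  forms \<open>V\<close> and \<open>Y\<close>. Then \<open>B\<close> is injective, and \<open>B c x = 0\<close> as soon as \<open>c\<close> is orthogonal to \<open>V x\<close>
  and \<open>Y x\<close>. Since \<open>2 Y x = sandwich V Y U x\<close> belongs to \<open>R\<close>, only the condition at \<open>V x\<close> is new,
  so the kernel of the evaluation has dimension at least \<open>n - dim R - 1\<close>. The two parts
  add up to \<open>n - 1\<close>, whatever \<open>dim R\<close> is (\<open>CARD_le_if_isotropic\<close>).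

  It remains to find such \<open>x\<close> and \<open>Y\<close>. If every \<open>V\<close>-isotropic vector \<open>x\<close> had \<open>Y x\<close> proportional to
  \<open>V x\<close>, then \<open>Y\<close> would be a multiple of \<open>V\<close> (\<open>multiple_if_isotropic_eigenvectors\<close>), which is
  excluded by \<open>trace (U Y) = 0\<close>. So there is a \<open>V\<close>-isotropic \<open>x\<close> with \<open>V x\<close> and \<open>Y x\<close> independent.
  If \<open>x\<close> is not isotropic for \<open>Y\<close>, then \<open>Y\<close> can be replaced by a suitable \<open>B c\<close>
  (\<open>CARD_le_if_isotropic_non_eigenvector\<close>).
\<close>

section \<open>Counting equations and rank-nullity over a field\<close>

text \<open>
  Every equation lowers the dimension by at most one.
\<close>

lemma (in finite_dimensional_vector_space) dim_le_dim_common_kernel: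
  assumes "subspace S" "finite I"
    and add: "\<And>i x y. i \<in> I \<Longrightarrow> f i (x + y) = f i x + f i y"
    and scale: "\<And>i c x. i \<in> I \<Longrightarrow> f i (scale c x) = c * f i x"
  shows "dim S \<le> dim {x \<in> S. \<forall>i\<in>I. f i x = 0} + card I"
  using \<open>finite I\<close> add scale
proof (induction I rule: finite_induct)
  case empty
  then show ?case by simp
next
  case (insert j I)
  define K where "K = {x \<in> S. \<forall>i\<in>I. f i x = 0}"
  define K' where "K' = {x \<in> K. f j x = 0}"
  have K'_eq: "{x \<in> S. \<forall>i\<in>insert j I. f i x = 0} = K'"
    by (auto simp: K_def K'_def)
  have "dim K \<le> dim K' + 1"
  proof (cases "K \<subseteq> K'")
    case True
    then show ?thesis
      using dim_subset[of K K'] by simp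
  next
    case False
    then obtain x0 where x0: "x0 \<in> K" "f j x0 \<noteq> 0"
      by (auto simp: K'_def)
    have "K \<subseteq> span (insert x0 K')"
    proof
      fix x assume x: "x \<in> K"
      define a where "a = f j x / f j x0"
      have [simp]: "f i 0 = 0" if "i \<in> insert j I" for i
        using insert.prems(2)[OF that, of 0 0] by simp
      have neg: "f i (- y) = - f i y" if "i \<in> insert j I" for i y
        using insert.prems(2)[OF that, of "-1" y] by simp
      have diff: "f i (y - z) = f i y - f i z" if "i \<in> insert j I" for i y z
        using insert.prems(1)[OF that, of y "- z"] neg[OF that, of z] by simp
      have "x - scale a x0 \<in> K'"
        using x x0 insert.prems(2) \<open>subspace S\<close>
        by (auto simp: K'_def K_def diff a_def subspace_diff subspace_scale)
      then have "(x - scale a x0) + scale a x0 \<in> span (insert x0 K')"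
        by (intro span_add span_scale) (auto intro: span_base)
      then show "x \<in> span (insert x0 K')"
        by simp
    qed
    then have "dim K \<le> dim (insert x0 K')"
      by (rule dim_mono)
    also have "\<dots> \<le> dim K' + 1"
      by (simp add: dim_insert)
    finally show ?thesis .
  qed
  moreover have "dim S \<le> dim K + card I"
    using insert.IH insert.prems by (simp add: K_def)
  ultimately show ?case
    unfolding K'_eq using insert.hyps by simp
qed

text \<open>
  The half of the rank-nullity theorem that bounds the dimension of the domain from below: extend a
  basis of the kernel to one of \<open>S\<close>; the images of the new basis vectors already span the image.
\<close>

lemma (in finite_dimensional_vector_space_pair) dim_image_plus_dim_kernel_le:
  assumes "Vector_Spaces.linear s1 s2 f" "vs1.subspace S"
  shows "vs2.dim (f ` S) + vs1.dim {x \<in> S. f x = 0} \<le> vs1.dim S"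
proof -
  interpret f: Vector_Spaces.linear s1 s2 f by fact
  define K where "K = {x \<in> S. f x = 0}"
  obtain B where B: "B \<subseteq> K" "vs1.independent B" "K \<subseteq> vs1.span B" "card B = vs1.dim K"
    using vs1.basis_exists by blast
  then have "B \<subseteq> S"
    by (auto simp: K_def)
  then obtain C where C: "B \<subseteq> C" "C \<subseteq> S" "vs1.independent C" "S \<subseteq> vs1.span C"
    using vs1.maximal_independent_subset_extend[OF _ B(2)] by metis
  have fin: "finite C"
    using C(3) by (rule vs1.finiteI_independent)
  have "f ` S \<subseteq> vs2.span (f ` C)"
    using C(4) by (metis f.span_image image_mono)
  also have "\<dots> \<subseteq> vs2.span (f ` (C - B))"
  proof (rule vs2.span_minimal)
    show "f ` C \<subseteq> vs2.span (f ` (C - B))"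
    proof
      fix y assume "y \<in> f ` C"
      then obtain x where x: "x \<in> C" "y = f x" by blast
      then show "y \<in> vs2.span (f ` (C - B))"
        using B(1) by (cases "x \<in> B") (auto simp: K_def vs2.span_zero intro: vs2.span_base)
    qed
  qed simp
  finally have "vs2.dim (f ` S) \<le> card (f ` (C - B))"
    using fin by (intro vs2.dim_le_card) auto
  also have "\<dots> \<le> card (C - B)"
    using fin by (intro card_image_le) auto
  also have "\<dots> = card C - card B"
    using fin C(1) by (intro card_Diff_subset) (auto intro: finite_subset)
  finally have "vs2.dim (f ` S) \<le> card C - card B" .
  moreover have "card C = vs1.dim S"
    using C by (intro vs1.basis_card_eq_dim) auto
  moreover have "card B \<le> card C"
    using fin C(1) by (rule card_mono)
  ultimately show ?thesis
    using B(4) by (simp add: K_def)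
qed

text \<open>
  The two interpretations give access to both directions: evaluation of matrices at a vector, and
  linear families of matrices parametrised by a vector.
\<close>

interpretation cmat_vec: finite_dimensional_vector_space_pair
  "(*\<^sub>M) :: complex \<Rightarrow> complex ^ 'n ^ 'n \<Rightarrow> complex ^ 'n ^ 'n" "range matrix_unit"
  "(*s) :: complex \<Rightarrow> complex ^ 'n \<Rightarrow> complex ^ 'n" cart_basis ..

interpretation vec_cmat: finite_dimensional_vector_space_pair
  "(*s) :: complex \<Rightarrow> complex ^ 'n \<Rightarrow> complex ^ 'n" cart_basis
  "(*\<^sub>M) :: complex \<Rightarrow> complex ^ 'n ^ 'n \<Rightarrow> complex ^ 'n ^ 'n" "range matrix_unit" ..

section \<open>The bilinear pairing on complex vectors\<close>

text \<open>
  The inner product on these vectors is real-valued and positive definite. The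
  pairing needed here is complex bilinear, so that symmetric matrices are self-adjoint and nonzero
  isotropic vectors exist.
\<close>

definition cdot :: "complex ^ 'n \<Rightarrow> complex ^ 'n \<Rightarrow> complex"  (infix "\<bullet>\<^sub>c" 70)
  where "a \<bullet>\<^sub>c b = (\<Sum>i\<in>UNIV. a $ i * b $ i)"

lemma cdot_commute: "a \<bullet>\<^sub>c b = b \<bullet>\<^sub>c a"
  by (simp add: cdot_def mult.commute)

lemma cdot_add_left [simp]: "(a + b) \<bullet>\<^sub>c c = a \<bullet>\<^sub>c c + b \<bullet>\<^sub>c c"
  and cdot_add_right [simp]: "c \<bullet>\<^sub>c (a + b) = c \<bullet>\<^sub>c a + c \<bullet>\<^sub>c b"
  and cdot_diff_left [simp]: "(a - b) \<bullet>\<^sub>c c = a \<bullet>\<^sub>c c - b \<bullet>\<^sub>c c"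
  and cdot_diff_right [simp]: "c \<bullet>\<^sub>c (a - b) = c \<bullet>\<^sub>c a - c \<bullet>\<^sub>c b"
  by (simp_all add: cdot_def algebra_simps sum.distrib sum_subtractf)

lemma cdot_scale_left [simp]: "(k *s a) \<bullet>\<^sub>c b = k * (a \<bullet>\<^sub>c b)"
  and cdot_scale_right [simp]: "a \<bullet>\<^sub>c (k *s b) = k * (a \<bullet>\<^sub>c b)"
  by (simp_all add: cdot_def sum_distrib_left algebra_simps)

lemma cdot_zero [simp]: "0 \<bullet>\<^sub>c a = 0" "a \<bullet>\<^sub>c 0 = 0"
  by (simp_all add: cdot_def)

lemma cdot_axis [simp]: "axis i k \<bullet>\<^sub>c a = k * a $ i"
  by (simp add: cdot_def axis_def if_distrib if_distribR cong: if_cong)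

lemma cdot_nondegenerate:
  assumes "p \<noteq> 0"
  obtains a where "a \<bullet>\<^sub>c p \<noteq> 0"
proof -
  obtain i where "p $ i \<noteq> 0"
    using assms by (auto simp: vec_eq_iff)
  then show thesis
    using that[of "axis i 1"] by simp
qed

lemma cdot_matrix_vector: "a \<bullet>\<^sub>c (A *v b) = (transpose A *v a) \<bullet>\<^sub>c b"
proof -
  have "a \<bullet>\<^sub>c (A *v b) = (\<Sum>i\<in>UNIV. \<Sum>j\<in>UNIV. a $ i * A $ i $ j * b $ j)"
    by (simp add: cdot_def matrix_vector_mult_def sum_distrib_left mult.assoc)
  also have "\<dots> = (\<Sum>j\<in>UNIV. \<Sum>i\<in>UNIV. a $ i * A $ i $ j * b $ j)"
    by (rule sum.swap)
  also have "\<dots> = (transpose A *v a) \<bullet>\<^sub>c b"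
    by (simp add: cdot_def matrix_vector_mult_def transpose_def sum_distrib_left mult_ac
        del: transpose_matrix_vector)
  finally show ?thesis .
qed

lemma cdot_symmetric_matrix:
  assumes "A \<in> symmetric_matrices"
  shows "a \<bullet>\<^sub>c (A *v b) = b \<bullet>\<^sub>c (A *v a)"
proof -
  have "transpose A = A"
    using assms by (simp add: symmetric_matrices_def)
  then show ?thesis
    using cdot_matrix_vector[of a A b] by (metis cdot_commute)
qed

lemma CARD_le_dim_orthogonal:
  fixes R :: "(complex ^ 'n) set"
  shows "CARD('n) \<le> vec.dim {c. \<forall>r\<in>R. r \<bullet>\<^sub>c c = 0} + vec.dim R"
proof -
  obtain B where B: "B \<subseteq> R" "vec.independent B" "R \<subseteq> vec.span B" "card B = vec.dim R"
    using vec.basis_exists by blast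
  have *: "r \<bullet>\<^sub>c c = 0" if "\<forall>b\<in>B. b \<bullet>\<^sub>c c = 0" "r \<in> R" for r c
  proof -
    have "vec.subspace {r. r \<bullet>\<^sub>c c = 0}"
      by (auto simp: vec.subspace_def)
    then have "vec.span B \<subseteq> {r. r \<bullet>\<^sub>c c = 0}"
      using that(1) by (intro vec.span_minimal) auto
    then show ?thesis
      using that(2) B(3) by auto
  qed
  have "vec.dim (UNIV :: (complex ^ 'n) set)
      \<le> vec.dim {c \<in> UNIV. \<forall>b\<in>B. b \<bullet>\<^sub>c c = 0} + card B"
    by (rule vec.dim_le_dim_common_kernel)
       (simp_all add: vec.finiteI_independent B)
  also have "{c \<in> UNIV. \<forall>b\<in>B. b \<bullet>\<^sub>c c = 0} = {c. \<forall>r\<in>R. r \<bullet>\<^sub>c c = 0}"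
    using B(1) * by auto
  finally show ?thesis
    by (simp add: B(4) card_cart_basis)
qed

section \<open>Symmetric products of two vectors\<close>

text \<open>
  Up to a factor, the quadratic form that is the product of the linear forms \<open>a\<close> and \<open>b\<close>.
\<close>

definition sprod :: "complex ^ 'n \<Rightarrow> complex ^ 'n \<Rightarrow> complex ^ 'n ^ 'n"
  where "sprod a b = (\<chi> i j. a $ i * b $ j + b $ i * a $ j)"

lemma sprod_symmetric: "sprod a b \<in> symmetric_matrices"
  by (simp add: symmetric_matrices_def sprod_def transpose_def algebra_simps vec_eq_iff)

lemma sprod_mult_vec: "sprod a b *v u = (b \<bullet>\<^sub>c u) *s a + (a \<bullet>\<^sub>c u) *s b"
  by (simp add: vec_eq_iff sprod_def matrix_vector_mult_def cdot_def
      sum_distrib_left sum_distrib_right sum.distrib algebra_simps)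

lemma trace_mult_sprod:
  assumes "X \<in> symmetric_matrices"
  shows "trace (X ** sprod a b) = 2 * (b \<bullet>\<^sub>c (X *v a))"
proof -
  have "trace (X ** sprod a b) = b \<bullet>\<^sub>c (X *v a) + a \<bullet>\<^sub>c (X *v b)"
    by (simp add: trace_def matrix_matrix_mult_def sprod_def cdot_def matrix_vector_mult_def
        sum_distrib_left sum.distrib algebra_simps)
  then show ?thesis
    using cdot_symmetric_matrix[OF assms, of a b] by simp
qed

text \<open>
  In terms of polynomials, \<open>p s + q t = 0\<close> for linear forms with \<open>p\<close> and \<open>q\<close> coprime, so only the
  Koszul relation remains. The proof evaluates the matrix identity at a vector \<open>a\<close> that is
  orthogonal to \<open>p\<close> but not to \<open>q\<close>, which expresses \<open>t\<close> in terms of \<open>p\<close> and \<open>q\<close>, and then eliminates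
  \<open>t\<close>.
\<close>

lemma sprod_syzygy:
  assumes "p \<noteq> 0" and indep: "\<And>k. q \<noteq> k *s p"
    and eq: "sprod p s + sprod q t = 0"
  obtains k where "t = k *s p" "s = - k *s q"
proof -
  have act: "(s \<bullet>\<^sub>c u) *s p + (p \<bullet>\<^sub>c u) *s s + ((t \<bullet>\<^sub>c u) *s q + (q \<bullet>\<^sub>c u) *s t) = 0" for u
    using arg_cong[OF eq, of "\<lambda>A. A *v u"]
    by (simp add: sprod_mult_vec matrix_vector_mult_add_rdistrib)
  obtain e where e: "e \<bullet>\<^sub>c p \<noteq> 0"
    using cdot_nondegenerate[OF \<open>p \<noteq> 0\<close>] .
  have "q - ((e \<bullet>\<^sub>c q) / (e \<bullet>\<^sub>c p)) *s p \<noteq> 0"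
    using indep by auto
  then obtain a0 where a0: "a0 \<bullet>\<^sub>c (q - ((e \<bullet>\<^sub>c q) / (e \<bullet>\<^sub>c p)) *s p) \<noteq> 0"
    using cdot_nondegenerate by blast
  \<comment> \<open>\<open>a0\<close> separates \<open>q\<close> from the multiples of \<open>p\<close>; correcting it by \<open>e\<close> makes it orthogonal to \<open>p\<close>.\<close>
  define a where "a = a0 - ((a0 \<bullet>\<^sub>c p) / (e \<bullet>\<^sub>c p)) *s e"
  have ap: "p \<bullet>\<^sub>c a = 0" and aq: "q \<bullet>\<^sub>c a \<noteq> 0"
    using e a0 by (simp_all add: a_def cdot_commute[of p] cdot_commute[of q] field_simps)
  define k l where "k = - (s \<bullet>\<^sub>c a) / (q \<bullet>\<^sub>c a)" and "l = - (t \<bullet>\<^sub>c a) / (q \<bullet>\<^sub>c a)"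
  have t: "t = k *s p + l *s q"
  proof -
    have "(q \<bullet>\<^sub>c a) *s t = (- (s \<bullet>\<^sub>c a)) *s p + (- (t \<bullet>\<^sub>c a)) *s q"
      using act[of a] ap by (simp add: vec_eq_iff add_eq_0_iff algebra_simps)
    then have "(1 / (q \<bullet>\<^sub>c a)) *s ((q \<bullet>\<^sub>c a) *s t)
        = (1 / (q \<bullet>\<^sub>c a)) *s ((- (s \<bullet>\<^sub>c a)) *s p + (- (t \<bullet>\<^sub>c a)) *s q)"
      by simp
    then show ?thesis
      using aq by (simp add: k_def l_def vec_eq_iff field_simps)
  qed
  \<comment> \<open>After substituting \<open>t\<close>, the relation becomes \<open>p s' + l q\<^sup>2 = 0\<close> as an identity of quadratic forms.\<close>
  define s' where "s' = s + k *s q"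
  have act': "(s' \<bullet>\<^sub>c u) *s p + (p \<bullet>\<^sub>c u) *s s' + (2 * l * (q \<bullet>\<^sub>c u)) *s q = 0" for u
    using act[of u] by (simp add: t s'_def vec_eq_iff algebra_simps)
  have "l = 0"
  proof (rule ccontr)
    assume "l \<noteq> 0"
    then have "q = (- (s' \<bullet>\<^sub>c a) / (2 * l * (q \<bullet>\<^sub>c a))) *s p"
      using act'[of a] ap aq
      by (simp add: vec_eq_iff field_simps add_eq_0_iff)
    then show False
      using indep by blast
  qed
  have pe: "p \<bullet>\<^sub>c e \<noteq> 0"
    using e by (simp add: cdot_commute)
  define h where "h = - (s' \<bullet>\<^sub>c e) / (p \<bullet>\<^sub>c e)"
  have s': "s' = h *s p"
    using act'[of e] pe \<open>l = 0\<close>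
    by (simp add: h_def vec_eq_iff field_simps add_eq_0_iff)
  have "h = 0"
  proof -
    have "(2 * h * (p \<bullet>\<^sub>c e)) *s p = 0"
      using act'[of e] by (simp add: s' \<open>l = 0\<close> vec_eq_iff algebra_simps)
    then show ?thesis
      using pe \<open>p \<noteq> 0\<close> by simp
  qed
  then have "s = - k *s q"
    using s' by (simp add: s'_def vec_eq_iff add_eq_0_iff2)
  with t \<open>l = 0\<close> show thesis
    using that[of k] by simp
qed

section \<open>The sandwich operator\<close>

text \<open>
  The polarisation of \<open>Z \<mapsto> Z X Z\<close>. For \<open>V = U\<inverse>\<close> it is the operation that the Jordan product
  with unit \<open>U\<close> induces on the annihilator of a Jordan subalgebra.
\<close>

definition sandwich :: "complex ^ 'n ^ 'n \<Rightarrow> complex ^ 'n ^ 'n \<Rightarrow> complex ^ 'n ^ 'n \<Rightarrow> complex ^ 'n ^ 'n"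
  where "sandwich V Y X = V ** X ** Y + Y ** X ** V"

lemma subspace_symmetric_matrices: "cmat.subspace symmetric_matrices"
  by (auto simp: cmat.subspace_def symmetric_matrices_def transpose_def vec_eq_iff)

lemma cmat_scale_mult_vec [simp]: "(k *\<^sub>M A) *v x = k *s (A *v x)"
  by (simp add: vec_eq_iff matrix_vector_mult_def sum_distrib_left mult.assoc)

lemma trace_scale [simp]: "trace (k *\<^sub>M A) = k * trace A"
  by (simp add: trace_def sum_distrib_left)

lemma mult_scale_left [simp]: "(k *\<^sub>M A) ** B = k *\<^sub>M (A ** B)"
  and mult_scale_right [simp]: "A ** (k *\<^sub>M B) = k *\<^sub>M (A ** B)"
  by (simp_all add: vec_eq_iff matrix_matrix_mult_def sum_distrib_left algebra_simps)

lemma matrix_mult_add_left: "(A + B) ** C = A ** C + B ** C" for A :: "complex ^ 'n ^ 'n"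
  by (simp add: vec_eq_iff matrix_matrix_mult_def sum.distrib algebra_simps)

lemma linear_apply: "Vector_Spaces.linear (*\<^sub>M) (*s) (\<lambda>Z. Z *v x)" for x :: "complex ^ 'n"
  unfolding Vector_Spaces.linear_iff
  by (simp add: cmat.vector_space_axioms vec.vector_space_axioms matrix_vector_mult_add_rdistrib)

lemma sandwich_symmetric:
  assumes "V \<in> symmetric_matrices" "Y \<in> symmetric_matrices" "X \<in> symmetric_matrices"
  shows "sandwich V Y X \<in> symmetric_matrices"
proof -
  have add: "transpose (A + B) = transpose A + transpose B" for A B :: "complex ^ 'n ^ 'n"
    by (simp add: transpose_def vec_eq_iff)
  show ?thesis
    using assms
    by (simp add: symmetric_matrices_def sandwich_def add matrix_transpose_mul matrix_mul_assoc add.commute)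
qed

lemma sandwich_add: "sandwich V Y (X + X') = sandwich V Y X + sandwich V Y X'"
  by (simp add: sandwich_def matrix_add_ldistrib matrix_mult_add_left)

lemma sandwich_scale: "sandwich V Y (k *\<^sub>M X) = k *\<^sub>M sandwich V Y X"
  by (simp add: sandwich_def cmat.scale_right_distrib)

text \<open>
  Self-adjointness of \<open>sandwich V Y\<close> for the trace form, by cyclic invariance of the trace.
\<close>

lemma trace_mult_sandwich: "trace (X ** sandwich V Y Z) = trace (sandwich V Y X ** Z)"
proof -
  have "trace (X ** V ** Z ** Y) = trace (Y ** X ** V ** Z)"
    using trace_mul_sym[of "X ** V ** Z" Y] by (simp add: matrix_mul_assoc)
  moreover have "trace (X ** Y ** Z ** V) = trace (V ** X ** Y ** Z)"
    using trace_mul_sym[of "X ** Y ** Z" V] by (simp add: matrix_mul_assoc)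
  ultimately show ?thesis
    by (simp add: sandwich_def matrix_add_ldistrib matrix_mult_add_left trace_add matrix_mul_assoc)
qed

lemma sandwich_sprod:
  assumes "V \<in> symmetric_matrices" "Y \<in> symmetric_matrices"
  shows "sandwich V Y (sprod x c) = sprod (V *v x) (Y *v c) + sprod (Y *v x) (V *v c)"
proof (subst matrix_eq, intro allI)
  fix u
  show "sandwich V Y (sprod x c) *v u = (sprod (V *v x) (Y *v c) + sprod (Y *v x) (V *v c)) *v u"
  proof -
    have move: "a \<bullet>\<^sub>c (V *v u) = (V *v a) \<bullet>\<^sub>c u" "a \<bullet>\<^sub>c (Y *v u) = (Y *v a) \<bullet>\<^sub>c u" for a
      using cdot_symmetric_matrix[OF assms(1)] cdot_symmetric_matrix[OF assms(2)]
      by (metis cdot_commute)+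
    show ?thesis
      by (simp add: sandwich_def sprod_mult_vec matrix_vector_mult_add_rdistrib move vec.add vec.scale
          add_ac flip: matrix_vector_mul_assoc)
  qed
qed

section \<open>Annihilators for the trace form\<close>

definition trace_annihilator :: "(complex ^ 'n ^ 'n) set \<Rightarrow> (complex ^ 'n ^ 'n) set"
  where "trace_annihilator L = {Y \<in> symmetric_matrices. \<forall>X\<in>L. trace (X ** Y) = 0}"

lemma subspace_trace_annihilator: "cmat.subspace (trace_annihilator L)"
  using subspace_symmetric_matrices
  by (auto simp: cmat.subspace_def trace_annihilator_def matrix_add_ldistrib trace_add)
     (simp add: trace_def)

text \<open>
  Pairing \<open>X\<close> with the symmetric product of two coordinate vectors gives twice an entry of \<open>X\<close>.
\<close>

lemma trace_form_nondegenerate: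
  assumes "X \<in> symmetric_matrices" "\<And>Y. Y \<in> symmetric_matrices \<Longrightarrow> trace (X ** Y) = 0"
  shows "X = 0"
proof -
  have "(X *v axis i 1) $ j = 0" for i j
    using assms(2)[OF sprod_symmetric, of "axis i 1" "axis j 1"] trace_mult_sprod[OF assms(1)]
    by simp
  moreover have "(X *v axis i 1) $ j = X $ j $ i" for i j
    by (simp add: matrix_vector_mult_def axis_def if_distrib cong: if_cong)
  ultimately show ?thesis
    by (simp add: vec_eq_iff)
qed

text \<open>
  Extend a basis of the annihilator to a basis \<open>C\<close> of all symmetric matrices. An element of \<open>L\<close> pairs
  to zero with the annihilator, so by nondegeneracy it is determined by its pairings with the
  new elements of \<open>C\<close>. Counting these bounds the dimension of \<open>L\<close>.
\<close>

lemma dim_add_dim_trace_annihilator_le: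
  fixes L :: "(complex ^ 'n ^ 'n) set"
  assumes "L \<subseteq> symmetric_matrices" "cmat.subspace L"
  shows "cmat.dim L + cmat.dim (trace_annihilator L)
    \<le> cmat.dim (symmetric_matrices :: (complex ^ 'n ^ 'n) set)"
proof -
  let ?S = "symmetric_matrices :: (complex ^ 'n ^ 'n) set" and ?M = "trace_annihilator L"
  obtain B where B: "B \<subseteq> ?M" "cmat.independent B" "?M \<subseteq> cmat.span B" "card B = cmat.dim ?M"
    using cmat.basis_exists by blast
  then have "B \<subseteq> ?S"
    by (auto simp: trace_annihilator_def)
  then obtain C where C: "B \<subseteq> C" "C \<subseteq> ?S" "cmat.independent C" "?S \<subseteq> cmat.span C"
    using cmat.maximal_independent_subset_extend[OF _ B(2)] by metis
  have fin: "finite C"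
    using C(3) by (rule cmat.finiteI_independent)
  have "X = 0" if X: "X \<in> L" "\<forall>Y\<in>C - B. trace (X ** Y) = 0" for X
  proof (rule trace_form_nondegenerate)
    show "X \<in> ?S"
      using X(1) assms(1) by blast
    have "cmat.subspace {Y. trace (X ** Y) = 0}"
      by (auto simp: cmat.subspace_def matrix_add_ldistrib trace_add) (simp add: trace_def)
    moreover have "C \<subseteq> {Y. trace (X ** Y) = 0}"
      using X B(1) by (auto simp: trace_annihilator_def)
    ultimately have "cmat.span C \<subseteq> {Y. trace (X ** Y) = 0}"
      by (intro cmat.span_minimal)
    then show "trace (X ** Y) = 0" if "Y \<in> ?S" for Y
      using that C(4) by auto
  qed
  then have zero: "{X \<in> L. \<forall>Y\<in>C - B. trace (X ** Y) = 0} \<subseteq> {0}"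
    by blast
  have "cmat.dim L \<le> cmat.dim {X \<in> L. \<forall>Y\<in>C - B. trace (X ** Y) = 0} + card (C - B)"
    using fin assms(2)
    by (intro cmat.dim_le_dim_common_kernel) (auto simp: matrix_mult_add_left trace_add)
  also have "cmat.dim {X \<in> L. \<forall>Y\<in>C - B. trace (X ** Y) = 0} = 0"
    using zero by simp
  also have "card (C - B) = card C - card B"
    using fin C(1) by (intro card_Diff_subset) (auto intro: finite_subset)
  finally have "cmat.dim L \<le> card C - card B" by simp
  moreover have "card C = cmat.dim ?S"
    using C by (intro cmat.basis_card_eq_dim) auto
  moreover have "card B \<le> card C"
    using fin C(1) by (rule card_mono)
  ultimately show ?thesis
    using B(4) by simp
qed

text \<open>
  The annihilator is cut out by one equation for each element of a basis of \<open>L\<close>, fewer than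
  the dimension of the space of symmetric matrices.
\<close>

lemma trace_annihilator_nonzero:
  fixes L :: "(complex ^ 'n ^ 'n) set"
  assumes "L \<subseteq> symmetric_matrices" "cmat.subspace L" "L \<noteq> symmetric_matrices"
  obtains Y where "Y \<in> trace_annihilator L" "Y \<noteq> 0"
proof -
  let ?S = "symmetric_matrices :: (complex ^ 'n ^ 'n) set"
  obtain B where B: "B \<subseteq> L" "cmat.independent B" "L \<subseteq> cmat.span B" "card B = cmat.dim L"
    using cmat.basis_exists by blast
  have "cmat.dim L < cmat.dim ?S"
    using assms subspace_symmetric_matrices
    by (metis cmat.dim_psubset cmat.span_eq_iff psubsetI)
  moreover have "cmat.dim ?S \<le> cmat.dim {Y \<in> ?S. \<forall>X\<in>B. trace (X ** Y) = 0} + card B"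
    using B(2) subspace_symmetric_matrices
    by (intro cmat.dim_le_dim_common_kernel)
       (auto simp: matrix_add_ldistrib trace_add cmat.finiteI_independent)
  ultimately have "cmat.dim {Y \<in> ?S. \<forall>X\<in>B. trace (X ** Y) = 0} \<noteq> 0"
    using B(4) by linarith
  then obtain Y where Y: "Y \<in> ?S" "\<forall>X\<in>B. trace (X ** Y) = 0" "Y \<noteq> 0"
    by auto
  have "cmat.subspace {X. trace (X ** Y) = 0}"
    by (auto simp: cmat.subspace_def matrix_mult_add_left trace_add) (simp add: trace_def)
  then have "cmat.span B \<subseteq> {X. trace (X ** Y) = 0}"
    using Y(2) by (intro cmat.span_minimal) auto
  then have "Y \<in> trace_annihilator L"
    using Y(1) B(3) by (auto simp: trace_annihilator_def)
  then show thesis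
    using Y(3) that by blast
qed

section \<open>Isotropic vectors of a symmetric matrix\<close>

text \<open>
  Over the complex numbers a quadratic form on a plane has a nontrivial root; the plane is spanned by
  two coordinate vectors.
\<close>

lemma exists_isotropic:
  assumes "CARD('n) \<ge> 2" "V \<in> symmetric_matrices"
  obtains x :: "complex ^ 'n" where "x \<noteq> 0" "x \<bullet>\<^sub>c (V *v x) = 0"
proof -
  obtain i j :: 'n where ij: "i \<noteq> j"
    using assms(1) by (metis One_nat_def card_1_singleton_iff card_le_Suc0_iff_eq finite not_less_eq_eq numeral_2_eq_2 UNIV_I)
  define a b :: "complex ^ 'n" where "a = axis i 1" and "b = axis j 1"
  show thesis
  proof (cases "b \<bullet>\<^sub>c (V *v b) = 0")
    case True
    then show thesis
      using that[of b] by (simp add: b_def)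
  next
    case False
    \<comment> \<open>Along the line \<open>a + t b\<close> the form is \<open>\<gamma> t\<^sup>2 + 2 \<beta> t + \<alpha>\<close>, and \<open>t\<close> is a root of it.\<close>
    define \<alpha> \<beta> \<gamma> where "\<alpha> = a \<bullet>\<^sub>c (V *v a)" and "\<beta> = a \<bullet>\<^sub>c (V *v b)" and "\<gamma> = b \<bullet>\<^sub>c (V *v b)"
    define t where "t = (csqrt (\<beta>\<^sup>2 - \<alpha> * \<gamma>) - \<beta>) / \<gamma>"
    have "(t * \<gamma> + \<beta>)\<^sup>2 = \<beta>\<^sup>2 - \<alpha> * \<gamma>"
      using False by (simp add: t_def \<gamma>_def)
    then have "\<gamma> * (\<alpha> + 2 * t * \<beta> + t\<^sup>2 * \<gamma>) = 0"
      by (simp add: power2_eq_square algebra_simps)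
    then have "\<alpha> + 2 * t * \<beta> + t\<^sup>2 * \<gamma> = 0"
      using False by (simp add: \<gamma>_def)
    then have "(a + t *s b) \<bullet>\<^sub>c (V *v (a + t *s b)) = 0"
      using cdot_symmetric_matrix[OF assms(2), of b a]
      by (simp add: vec.add vec.scale \<alpha>_def \<beta>_def \<gamma>_def power2_eq_square algebra_simps)
    moreover have "(a + t *s b) $ i \<noteq> 0"
      using ij by (simp add: a_def b_def axis_def)
    then have "a + t *s b \<noteq> 0"
      by (metis zero_index)
    ultimately show thesis
      using that by blast
  qed
qed

text \<open>
  Symmetry of \<open>V\<close> and \<open>Y\<close> forces isotropic vectors that are not \<open>V\<close>-orthogonal to have the same
  eigenvalue. Every vector \<open>a\<close> that is not \<open>V\<close>-orthogonal to \<open>x\<close> becomes isotropic after subtracting a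
  multiple of \<open>x\<close>, so all these \<open>a\<close> have the eigenvalue \<open>k\<close> of \<open>x\<close>; and they span the space, being
  the complement of a hyperplane.
\<close>

lemma multiple_if_isotropic_eigenvectors:
  assumes V: "V \<in> symmetric_matrices" "\<And>x. V *v x = 0 \<Longrightarrow> x = 0"
    and Y: "Y \<in> symmetric_matrices"
    and x: "x \<noteq> 0" "x \<bullet>\<^sub>c (V *v x) = 0"
    and eigen: "\<And>x. x \<bullet>\<^sub>c (V *v x) = 0 \<Longrightarrow> \<exists>k. Y *v x = k *s (V *v x)"
  obtains k where "Y = k *\<^sub>M V"
proof -
  obtain k where k: "Y *v x = k *s (V *v x)"
    using eigen[OF x(2)] by blast
  have 1: "Y *v a = k *s (V *v a)" if a: "a \<bullet>\<^sub>c (V *v x) \<noteq> 0" for a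
  proof -
    have xa: "x \<bullet>\<^sub>c (V *v a) = a \<bullet>\<^sub>c (V *v x)"
      using V(1) by (rule cdot_symmetric_matrix)
    define s where "s = (a \<bullet>\<^sub>c (V *v a)) / (2 * (a \<bullet>\<^sub>c (V *v x)))"
    define b where "b = a - s *s x"
    have "b \<bullet>\<^sub>c (V *v b) = 0"
      using a x(2) xa by (simp add: b_def vec.diff vec.scale s_def algebra_simps)
    then obtain l where l: "Y *v b = l *s (V *v b)"
      using eigen by blast
    have bx: "b \<bullet>\<^sub>c (V *v x) = a \<bullet>\<^sub>c (V *v x)"
      using x(2) by (simp add: b_def)
    have "l * (b \<bullet>\<^sub>c (V *v x)) = x \<bullet>\<^sub>c (Y *v b)"
      using cdot_symmetric_matrix[OF V(1), of x b] by (simp add: l)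
    also have "\<dots> = k * (b \<bullet>\<^sub>c (V *v x))"
      using cdot_symmetric_matrix[OF Y, of x b] by (simp add: k)
    finally have "l = k"
      using bx a by simp
    then have "Y *v (b + s *s x) = k *s (V *v (b + s *s x))"
      using k l by (simp add: vec.add vec.scale vec_eq_iff algebra_simps)
    then show ?thesis
      by (simp add: b_def)
  qed
  obtain a where a: "a \<bullet>\<^sub>c (V *v x) \<noteq> 0"
    using cdot_nondegenerate V(2) x(1) by metis
  have "Y *v b = k *s (V *v b)" for b
  proof (cases "b \<bullet>\<^sub>c (V *v x) = 0")
    case True
    then have "Y *v (b + a) - Y *v a = k *s (V *v (b + a)) - k *s (V *v a)"
      using a by (simp add: 1)
    then show ?thesis
      by (simp add: vec.add vec_eq_iff algebra_simps)
  qed (rule 1)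
  then have "Y = k *\<^sub>M V"
    by (subst matrix_eq) simp
  then show thesis
    by (rule that)
qed

section \<open>The annihilator of a Jordan subalgebra\<close>

text \<open>
  A Jordan subalgebra with unit \<open>U\<close>. The factor \<open>1/2\<close> of the Jordan product is absorbed into the
  subspace, and the inverse \<open>V\<close> of the unit is a parameter because all computations are done
  with it.
\<close>

locale jordan_space =
  fixes L :: "(complex ^ 'n ^ 'n) set" and U V :: "complex ^ 'n ^ 'n"
  assumes L_symmetric: "L \<subseteq> symmetric_matrices"
    and subspace_L: "cmat.subspace L"
    and unit_mem: "U \<in> L"
    and V_U: "V ** U = mat 1" and U_V: "U ** V = mat 1"
    and jordan_closed: "\<And>X Z. X \<in> L \<Longrightarrow> Z \<in> L \<Longrightarrow> X ** V ** Z + Z ** V ** X \<in> L"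
begin

abbreviation "M \<equiv> trace_annihilator L"

lemma V_symmetric: "V \<in> symmetric_matrices"
proof -
  have "transpose U = U"
    using unit_mem L_symmetric by (auto simp: symmetric_matrices_def)
  then have "transpose V ** U = mat 1"
    using arg_cong[OF U_V, of transpose] by (simp add: matrix_transpose_mul)
  then have "transpose V ** U ** V = V"
    by simp
  then show ?thesis
    by (simp add: symmetric_matrices_def U_V flip: matrix_mul_assoc)
qed

lemma V_injective: "V *v x = V *v y \<longleftrightarrow> x = y"
  using U_V by (metis matrix_vector_mul_assoc matrix_vector_mul_lid)

lemma V_zero: "V *v x = 0 \<Longrightarrow> x = 0"
  using V_injective[of x 0] by simp

lemma annihilator_symmetric: "Y \<in> M \<Longrightarrow> Y \<in> symmetric_matrices"
  by (simp add: trace_annihilator_def)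

text \<open>
  Moving \<open>X\<close> across the trace form turns the sandwich into twice the Jordan product of \<open>X\<close> and \<open>Z\<close>,
  which \<open>Y\<close> annihilates.
\<close>

lemma sandwich_mem_annihilator:
  assumes "X \<in> L" "Y \<in> M"
  shows "sandwich V Y X \<in> M"
  unfolding trace_annihilator_def
proof (intro CollectI conjI ballI)
  show "sandwich V Y X \<in> symmetric_matrices"
    using assms L_symmetric V_symmetric annihilator_symmetric by (blast intro: sandwich_symmetric)
next
  fix Z assume Z: "Z \<in> L"
  have "trace (Z ** Y ** X ** V) = trace (X ** V ** Z ** Y)"
    using trace_mul_sym[of "Z ** Y" "X ** V"] by (simp add: matrix_mul_assoc)
  then have "trace (Z ** sandwich V Y X) = trace ((X ** V ** Z + Z ** V ** X) ** Y)"
    by (simp add: sandwich_def matrix_add_ldistrib matrix_mult_add_left trace_add matrix_mul_assoc)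
  also have "\<dots> = 0"
    using jordan_closed[OF assms(1) Z] assms(2) by (auto simp: trace_annihilator_def)
  finally show "trace (Z ** sandwich V Y X) = 0" .
qed

definition "orbit Y x = (\<lambda>X. sandwich V Y X *v x) ` L"

text \<open>
  Self-adjointness moves \<open>sandwich V Y\<close> from the symmetric product of \<open>x\<close> and \<open>c\<close> to a member \<open>X\<close> of
  \<open>L\<close>; what remains is the pairing of \<open>c\<close> with an element of the orbit.
\<close>

lemma sandwich_sprod_mem_annihilator:
  assumes "Y \<in> M" "\<forall>r\<in>orbit Y x. r \<bullet>\<^sub>c c = 0"
  shows "sandwich V Y (sprod x c) \<in> M"
  unfolding trace_annihilator_def
proof (intro CollectI conjI ballI)
  show "sandwich V Y (sprod x c) \<in> symmetric_matrices"
    using assms V_symmetric annihilator_symmetric sprod_symmetric by (blast intro: sandwich_symmetric)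
next
  fix X assume X: "X \<in> L"
  have "sandwich V Y X \<in> symmetric_matrices"
    using X assms(1) sandwich_mem_annihilator annihilator_symmetric by blast
  then have "trace (X ** sandwich V Y (sprod x c)) = 2 * (c \<bullet>\<^sub>c (sandwich V Y X *v x))"
    by (simp add: trace_mult_sandwich trace_mult_sprod)
  also have "\<dots> = 0"
    using assms(2) X by (simp add: orbit_def cdot_commute)
  finally show "trace (X ** sandwich V Y (sprod x c)) = 0" .
qed

lemma dim_orbit_le: "vec.dim (orbit Y x) \<le> vec.dim ((\<lambda>Z. Z *v x) ` M)" if "Y \<in> M"
  using that by (intro vec.dim_subset) (auto simp: orbit_def sandwich_mem_annihilator)

text \<open>
  The unit of \<open>L\<close> contributes \<open>2 Y x\<close> to the orbit.
\<close>

lemma apply_orthogonal_if_orbit_orthogonal: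
  assumes "\<forall>r\<in>orbit Y x. r \<bullet>\<^sub>c c = 0"
  shows "(Y *v x) \<bullet>\<^sub>c c = 0"
proof -
  have "Y ** U ** V = Y"
    by (simp add: U_V flip: matrix_mul_assoc)
  then have "sandwich V Y U *v x = Y *v x + Y *v x"
    by (simp only: sandwich_def V_U matrix_mul_lid matrix_vector_mult_add_rdistrib)
  moreover have "sandwich V Y U *v x \<in> orbit Y x"
    using unit_mem by (auto simp: orbit_def)
  ultimately have "(Y *v x + Y *v x) \<bullet>\<^sub>c c = 0"
    using assms by metis
  then show ?thesis
    by (simp only: cdot_add_left) simp
qed

lemma CARD_le_dim_orbit:
  "CARD('n) \<le> vec.dim {c. (\<forall>r\<in>orbit Y x. r \<bullet>\<^sub>c c = 0) \<and> (V *v x) \<bullet>\<^sub>c c = 0} + vec.dim (orbit Y x) + 1"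
proof -
  have "CARD('n) \<le> vec.dim {c. \<forall>r\<in>insert (V *v x) (orbit Y x). r \<bullet>\<^sub>c c = 0}
      + vec.dim (insert (V *v x) (orbit Y x))"
    by (rule CARD_le_dim_orthogonal)
  moreover have "vec.dim (insert (V *v x) (orbit Y x)) \<le> vec.dim (orbit Y x) + 1"
    by (simp add: vec.dim_insert)
  ultimately show ?thesis
    by (simp add: conj_commute)
qed

lemma sandwich_sprod_apply:
  assumes "Y \<in> M" "(\<forall>r\<in>orbit Y x. r \<bullet>\<^sub>c c = 0)" "(V *v x) \<bullet>\<^sub>c c = 0" "x \<bullet>\<^sub>c (V *v x) = 0"
  shows "sandwich V Y (sprod x c) *v x = (x \<bullet>\<^sub>c (Y *v x)) *s (V *v c)"
proof -
  have "x \<bullet>\<^sub>c (Y *v c) = 0" "x \<bullet>\<^sub>c (V *v c) = 0"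
    using apply_orthogonal_if_orbit_orthogonal[OF assms(2)] assms(3) V_symmetric annihilator_symmetric[OF assms(1)]
    by (metis cdot_commute cdot_symmetric_matrix)+
  then show ?thesis
    using assms(4)
    by (simp add: sandwich_sprod V_symmetric annihilator_symmetric assms(1) sprod_mult_vec
        matrix_vector_mult_add_rdistrib cdot_commute[of _ x])
qed

text \<open>
  By the syzygy lemma \<open>V c = k V x\<close> and \<open>Y c = - k Y x\<close>. The first equation gives \<open>c = k x\<close>, and the
  opposite sign in the second leaves only \<open>k = 0\<close>.
\<close>

lemma sandwich_sprod_injective:
  assumes "Y \<in> M" "\<And>k. Y *v x \<noteq> k *s (V *v x)" "sandwich V Y (sprod x c) = 0"
  shows "c = 0"
proof -
  have "x \<noteq> 0"
    using assms(2)[of 0] by auto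
  then have "V *v x \<noteq> 0"
    using V_zero by blast
  moreover have "sprod (V *v x) (Y *v c) + sprod (Y *v x) (V *v c) = 0"
    using assms by (simp add: sandwich_sprod V_symmetric annihilator_symmetric)
  ultimately obtain k where k: "V *v c = k *s (V *v x)" "Y *v c = - k *s (Y *v x)"
    using sprod_syzygy assms(2) by metis
  then have "V *v c = V *v (k *s x)"
    by (simp add: vec.scale)
  then have c: "c = k *s x"
    by (simp only: V_injective)
  have "k *s (Y *v x) = - k *s (Y *v x)"
    using k(2) unfolding c by (simp only: vec.scale)
  then have "(2 * k) *s (Y *v x) = 0"
    by (simp add: vec_eq_iff)
  moreover have "Y *v x \<noteq> 0"
    using assms(2)[of 0] by auto
  ultimately show ?thesis
    using c by simp
qed

text \<open>
  The orbit and its orthogonal complement contribute to different parts of \<open>M\<close>: the orbit to the image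
  of the evaluation at \<open>x\<close>, the complement to its kernel. The \<open>1\<close> on the right is the price of making
  \<open>c\<close> orthogonal to \<open>V x\<close>.
\<close>

lemma CARD_le_if_isotropic:
  assumes "Y \<in> M" "\<And>k. Y *v x \<noteq> k *s (V *v x)" "x \<bullet>\<^sub>c (V *v x) = 0" "x \<bullet>\<^sub>c (Y *v x) = 0"
  shows "CARD('n) \<le> cmat.dim M + 1"
proof -
  define C where "C = {c. (\<forall>r\<in>orbit Y x. r \<bullet>\<^sub>c c = 0) \<and> (V *v x) \<bullet>\<^sub>c c = 0}"
  define f where "f c = sandwich V Y (sprod x c)" for c
  have lin: "Vector_Spaces.linear (*s) (*\<^sub>M) f"
  proof -
    have "sprod x (c + d) = sprod x c + sprod x d" "sprod x (k *s c) = k *\<^sub>M sprod x c" for c d k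
      by (simp_all add: sprod_def vec_eq_iff algebra_simps)
    then show ?thesis
      unfolding Vector_Spaces.linear_iff f_def
      by (simp add: cmat.vector_space_axioms vec.vector_space_axioms sandwich_add sandwich_scale)
  qed
  interpret f: Vector_Spaces.linear "(*s)" "(*\<^sub>M)" f
    by (rule lin)
  have "inj f"
    unfolding f.inj_iff_eq_0 using sandwich_sprod_injective[OF assms(1,2)] by (auto simp: f_def)
  then have "cmat.dim (f ` C) = vec.dim C"
    using lin by (intro vec_cmat.dim_image_eq) (auto intro: inj_on_subset)
  moreover have "f ` C \<subseteq> {Z \<in> M. Z *v x = 0}"
    using assms sandwich_sprod_mem_annihilator sandwich_sprod_apply by (auto simp: C_def f_def)
  then have "cmat.dim (f ` C) \<le> cmat.dim {Z \<in> M. Z *v x = 0}"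
    by (rule cmat.dim_subset)
  moreover have "vec.dim ((\<lambda>Z. Z *v x) ` M) + cmat.dim {Z \<in> M. Z *v x = 0} \<le> cmat.dim M"
    by (rule cmat_vec.dim_image_plus_dim_kernel_le[OF linear_apply subspace_trace_annihilator])
  moreover have "CARD('n) \<le> vec.dim C + vec.dim (orbit Y x) + 1"
    unfolding C_def by (rule CARD_le_dim_orbit)
  ultimately show ?thesis
    using dim_orbit_le[OF assms(1), of x] by linarith
qed

text \<open>
  If the bound failed, the orbit would be so small that a nonzero \<open>c\<close> is orthogonal to it and to
  \<open>V x\<close>. Then \<open>Z = sandwich V Y (sprod x c)\<close> satisfies \<open>Z x = (x\<^sup>T Y x) V c\<close>. So \<open>x\<close> is isotropic for
  \<open>Z\<close>, and \<open>Z x\<close> is not a multiple of \<open>V x\<close> because \<open>c\<close> is orthogonal to \<open>Y x\<close> while \<open>x\<close> is not.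
  Hence \<open>CARD_le_if_isotropic\<close> applies to \<open>Z\<close>.
\<close>

lemma CARD_le_if_isotropic_non_eigenvector:
  assumes "Y \<in> M" "\<And>k. Y *v x \<noteq> k *s (V *v x)" "x \<bullet>\<^sub>c (V *v x) = 0"
  shows "CARD('n) \<le> cmat.dim M + 1"
proof (rule ccontr)
  assume neg: "\<not> ?thesis"
  define C where "C = {c. (\<forall>r\<in>orbit Y x. r \<bullet>\<^sub>c c = 0) \<and> (V *v x) \<bullet>\<^sub>c c = 0}"
  have nz: "x \<bullet>\<^sub>c (Y *v x) \<noteq> 0"
    using CARD_le_if_isotropic[OF assms] neg by blast
  have "vec.dim (orbit Y x) \<le> cmat.dim M"
    using dim_orbit_le[OF assms(1), of x] cmat_vec.dim_image_le[OF linear_apply, of x M] by linarith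
  then have "vec.dim C \<noteq> 0"
    using CARD_le_dim_orbit[of Y x] neg unfolding C_def by linarith
  then obtain c where c: "c \<in> C" "c \<noteq> 0"
    by auto
  then have c': "\<forall>r\<in>orbit Y x. r \<bullet>\<^sub>c c = 0" "(V *v x) \<bullet>\<^sub>c c = 0"
    by (auto simp: C_def)
  define Z where "Z = sandwich V Y (sprod x c)"
  have Z: "Z \<in> M" "Z *v x = (x \<bullet>\<^sub>c (Y *v x)) *s (V *v c)"
    using sandwich_sprod_mem_annihilator sandwich_sprod_apply assms c' by (auto simp: Z_def)
  have "Z *v x \<noteq> k *s (V *v x)" for k
  proof
    assume "Z *v x = k *s (V *v x)"
    then have "V *v ((x \<bullet>\<^sub>c (Y *v x)) *s c) = V *v (k *s x)"
      by (simp add: Z vec.scale)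
    then have eq: "(x \<bullet>\<^sub>c (Y *v x)) *s c = k *s x"
      by (simp only: V_injective)
    have "k * (x \<bullet>\<^sub>c (Y *v x)) = (x \<bullet>\<^sub>c (Y *v x)) * ((Y *v x) \<bullet>\<^sub>c c)"
      by (metis eq cdot_commute cdot_scale_left cdot_scale_right)
    also have "\<dots> = 0"
      using apply_orthogonal_if_orbit_orthogonal[OF c'(1)] by simp
    finally have "k = 0"
      using nz by simp
    with eq nz c(2) show False
      by simp
  qed
  moreover have "x \<bullet>\<^sub>c (Z *v x) = 0"
    using c'(2) cdot_symmetric_matrix[OF V_symmetric, of x c] by (simp add: Z cdot_commute)
  ultimately show False
    using CARD_le_if_isotropic[OF Z(1) _ assms(3)] neg by blast
qed

text \<open>
  For \<open>Y = k V\<close>, the pairing with the unit is \<open>k n\<close>, and it vanishes for members of \<open>M\<close>.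
\<close>

lemma annihilator_not_multiple:
  assumes "Y \<in> M" "Y = k *\<^sub>M V"
  shows "Y = 0"
proof -
  have "trace (U ** Y) = 0"
    using assms(1) unit_mem by (simp add: trace_annihilator_def)
  then have "k = 0"
    by (simp add: assms(2) U_V trace_I)
  then show ?thesis
    by (simp add: assms(2))
qed

lemma CARD_le_dim_annihilator:
  assumes "L \<noteq> symmetric_matrices"
  shows "CARD('n) \<le> cmat.dim M + 1"
proof (cases "CARD('n) \<ge> 2")
  case True
  obtain Y where Y: "Y \<in> M" "Y \<noteq> 0"
    using trace_annihilator_nonzero[OF L_symmetric subspace_L assms] .
  obtain x0 where x0: "x0 \<noteq> 0" "x0 \<bullet>\<^sub>c (V *v x0) = 0"
    using exists_isotropic[OF True V_symmetric] .
  have "\<exists>x. x \<bullet>\<^sub>c (V *v x) = 0 \<and> (\<forall>k. Y *v x \<noteq> k *s (V *v x))"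
  proof (rule ccontr)
    assume "\<nexists>x. x \<bullet>\<^sub>c (V *v x) = 0 \<and> (\<forall>k. Y *v x \<noteq> k *s (V *v x))"
    then obtain k where "Y = k *\<^sub>M V"
      using multiple_if_isotropic_eigenvectors[OF V_symmetric V_zero annihilator_symmetric[OF Y(1)] x0]
      by blast
    then show False
      using annihilator_not_multiple Y by blast
  qed
  then show ?thesis
    using CARD_le_if_isotropic_non_eigenvector[OF Y(1)] by blast
qed simp

lemma CARD_minus_one_le_codim:
  assumes "L \<noteq> symmetric_matrices"
  shows "CARD('n) - 1 \<le> codim_in symmetric_matrices L"
  using CARD_le_dim_annihilator[OF assms] dim_add_dim_trace_annihilator_le[OF L_symmetric subspace_L]
  by (simp add: codim_in_def)

end

theorem theorem4p1:
  fixes L :: "(complex ^ 'n ^ 'n) set"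
  assumes "jordan_subalgebra L"
    and "L \<noteq> symmetric_matrices"
  shows "codim_in symmetric_matrices L \<ge> CARD('n) - 1"
proof -
  obtain U where L: "L \<subseteq> symmetric_matrices" "cmat.subspace L" "U \<in> L" "invertible U"
    and prod: "\<And>X Z. X \<in> L \<Longrightarrow> Z \<in> L \<Longrightarrow> jordan_prod U X Z \<in> L"
    using assms(1) by (auto simp: jordan_subalgebra_def)
  have inv: "U ** matrix_inv U = mat 1 \<and> matrix_inv U ** U = mat 1"
    using L(4) unfolding invertible_def matrix_inv_def by (rule someI_ex)
  interpret jordan_space L U "matrix_inv U"
  proof
    fix X Z assume "X \<in> L" "Z \<in> L"
    then have "2 *\<^sub>M jordan_prod U X Z \<in> L"
      using prod L(2) by (simp add: cmat.subspace_scale)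
    then show "X ** matrix_inv U ** Z + Z ** matrix_inv U ** X \<in> L"
      by (simp add: jordan_prod_def)
  qed (use L inv in auto)
  show ?thesis
    using assms(2) by (rule CARD_minus_one_le_codim)
qed

end
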